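(* Let $X$ be a set with at least two elements, $\Gamma$ a nonempty set, $\varphi:\Gamma\to\Gamma$ an arbitrary map, and let $\sigma_\varphi:X^\Gamma\to X^\Gamma$, $\sigma_\varphi((x_\alpha)_{\alpha\in\Gamma})=(x_{\varphi(\alpha)})_{\alpha\in\Gamma}$, be the generalized shift. The following statements are equivalent: (1) $W(\sigma_\varphi)=\varnothing$ (i.e., $\mathfrak{o}(\sigma_\varphi)=\mathrm{ent}_{\rm set}(\sigma_\varphi)=0$); (2) $\varphi$ is quasi-periodic; (3) $\mathrm{ent}_{\rm set}(\sigma_\varphi)<\infty$ (i.e., $\mathfrak{o}(\sigma_\varphi)<\infty$).
   Context: For a self-map $g:A\to A$: $g$ is quasi-periodic if there exist $n>m\geq 1$ with $g^n=g^m$. A point $a\in A$ is a wandering point of $g$ if its orbit $\{g^n(a):n\geq0\}$ is infinite; $W(g)$ is the set of all wandering points of $g$. The infinite orbit number $\mathfrak{o}(g)\in\{0,1,2,\ldots\}\cup\{\infty\}$ is $\sup(\{0\}\cup\{k\geq1:$ there exist $k$ pairwise disjoint infinite orbits of $g\})$. For a finite subset $D\subseteq A$ put $\mathrm{ent}_{\rm set}(g,D)=\lim_{n\to\infty}\frac{|D\cup g(D)\cup\cdots\cup g^{n-1}(D)|}{n}$ (the limit exists), and the set-theoretical entropy of $g$ is $\mathrm{ent}_{\rm set}(g)=\sup\{\mathrm{ent}_{\rm set}(g,D): D\text{ a finite subset of }A\}$. It is known that $\mathrm{ent}_{\rm set}(g)=\mathfrak{o}(g)$. All infinite cardinalities are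 denoted by the single symbol $\infty$. *)

theory Defs
  imports "HOL-Analysis.Analysis"
begin

text \<open>
  A self-map of a set \<open>A\<close> is a function \<open>g\<close> on the ambient type with \<open>g \<in> A \<rightarrow> A\<close>; its values
  outside \<open>A\<close> are irrelevant, so equality of iterates is only required on \<open>A\<close>.
\<close>

definition quasi_periodic_on :: "'a set \<Rightarrow> ('a \<Rightarrow> 'a) \<Rightarrow> bool" where
  "quasi_periodic_on A g \<longleftrightarrow>
     (\<exists>n m. n > m \<and> m \<ge> 1 \<and> (\<forall>a\<in>A. (g ^^ n) a = (g ^^ m) a))"

definition fwd_orbit :: "('a \<Rightarrow> 'a) \<Rightarrow> 'a \<Rightarrow> 'a set" where
  "fwd_orbit g a = {(g ^^ n) a | n. n \<ge> 0}"

definition wandering_points :: "'a set \<Rightarrow> ('a \<Rightarrow> 'a) \<Rightarrow> 'a set" where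
  "wandering_points A g = {a \<in> A. infinite (fwd_orbit g a)}"

text \<open>
  In the set \<open>\<O>\<close> below, \<open>card \<O> = k\<close> with \<open>k \<ge> 1\<close> forces \<open>\<O>\<close> to be finite, and pairwise disjoint
  infinite orbits are distinct, so \<open>\<O>\<close> consists of exactly \<open>k\<close> orbits.
\<close>

definition infinite_orbit_number :: "'a set \<Rightarrow> ('a \<Rightarrow> 'a) \<Rightarrow> enat" where
  "infinite_orbit_number A g =
     Sup ({0} \<union> {enat k | k. k \<ge> 1 \<and>
       (\<exists>\<O>. \<O> \<subseteq> fwd_orbit g ` A \<and> card \<O> = k \<and>
            (\<forall>S\<in>\<O>. infinite S) \<and> pairwise disjnt \<O>)})"

text \<open>
  For finite \<open>D\<close> the limit exists: the increments of the numerator are nonincreasing, since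
  the image under \<open>g\<close> of the elements that are new at one step covers those new at the next.
\<close>

definition set_entropy_at :: "('a \<Rightarrow> 'a) \<Rightarrow> 'a set \<Rightarrow> real" where
  "set_entropy_at g D =
     lim (\<lambda>n. real (card (\<Union>i<n. (g ^^ i) ` D)) / real n)"

definition set_entropy :: "'a set \<Rightarrow> ('a \<Rightarrow> 'a) \<Rightarrow> ereal" where
  "set_entropy A g = (SUP D \<in> {D. finite D \<and> D \<subseteq> A}. ereal (set_entropy_at g D))"

text \<open>
  The power \<open>X\<^sup>\<Gamma>\<close> is \<open>\<Gamma> \<rightarrow>\<^sub>E X\<close>, whose members are \<open>undefined\<close> off \<open>\<Gamma>\<close>; the restriction keeps the
  shift inside this set.
\<close>

definition generalized_shift :: "'g set \<Rightarrow> ('g \<Rightarrow> 'g) \<Rightarrow> ('g \<Rightarrow> 'x) \<Rightarrow> ('g \<Rightarrow> 'x)" where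
  "generalized_shift \<Gamma> \<phi> x = (\<lambda>\<alpha>\<in>\<Gamma>. x (\<phi> \<alpha>))"

end

theory Submission
  imports Defs
begin

text \<open>
  If \<open>\<phi>\<close> satisfies \<open>\<phi>\<^sup>n = \<phi>\<^sup>m\<close> with \<open>n > m\<close>, then so does the shift, because \<open>\<sigma>\<^sup>n\<close> is the shift along
  \<open>\<phi>\<^sup>n\<close>. Every orbit of \<open>\<sigma>\<close> is then finite, and finiteness of all orbits makes both the infinite
  orbit number and the entropy vanish.

  If \<open>\<phi>\<close> is not quasi-periodic, the shift is as far from this as possible: there are points
  \<open>x\<^sub>0, x\<^sub>1, \<dots>\<close> of the power such that all the iterates \<open>\<sigma>\<^sup>i x\<^sub>j\<close> are distinct (lemma
  \<open>not_quasi_periodic_imp_independent_points\<close>). Their orbits are infinite and pairwise disjoint, and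
  any \<open>k\<close> of the points have entropy exactly \<open>k\<close>; hence wandering points exist and both the orbit number
  and the entropy are infinite. So each of the conditions holds precisely when \<open>\<phi>\<close> is
  quasi-periodic.

  The points \<open>x\<^sub>j\<close> are obtained generically instead of by a case distinction on how \<open>\<phi>\<close> fails to be
  quasi-periodic (an infinite orbit, unbounded preperiods, or unbounded periods). The inequality
  \<open>\<sigma>\<^sup>i x\<^sub>j \<noteq> \<sigma>\<^sup>k x\<^sub>l\<close> asks for some \<open>\<alpha>\<close> with \<open>x\<^sub>j (\<phi>\<^sup>i \<alpha>) \<noteq> x\<^sub>l (\<phi>\<^sup>k \<alpha>)\<close>. These are countably many
  requirements, and they can be met one after the other, each fixing only two more values, provided
  that each can be satisfied outside any given finite set. For \<open>j = l\<close> this says that infinitely many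
  values \<open>\<phi>\<^sup>i \<alpha>\<close> differ from the corresponding \<open>\<phi>\<^sup>k \<alpha>\<close>, and lemma \<open>quasi_periodic_on_if_finite_moved\<close>
  shows that this can only fail for quasi-periodic \<open>\<phi>\<close>.
\<close>

section \<open>Self-maps all of whose orbits are finite\<close>

lemma fwd_orbit_eq_range: "fwd_orbit g a = range (\<lambda>n. (g ^^ n) a)"
  by (auto simp: fwd_orbit_def)

lemma quasi_periodic_on_imp_finite_fwd_orbit:
  assumes "quasi_periodic_on A g" "a \<in> A"
  shows "finite (fwd_orbit g a)"
proof -
  obtain n m where nm: "m < n" and eq: "(g ^^ n) a = (g ^^ m) a"
    using assms unfolding quasi_periodic_on_def by blast
  have "(g ^^ k) a \<in> (\<lambda>i. (g ^^ i) a) ` {..<n}" for k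
  proof (induction k rule: less_induct)
    case (less k)
    show ?case
    proof (cases "k < n")
      case False
      have "(g ^^ k) a = (g ^^ (k - n + n)) a"
        using False by simp
      also have "\<dots> = (g ^^ (k - n + m)) a"
        by (simp only: funpow_add comp_apply eq)
      finally show ?thesis
        using less.IH[of "k - n + m"] nm False by simp
    qed blast
  qed
  then have "fwd_orbit g a \<subseteq> (\<lambda>i. (g ^^ i) a) ` {..<n}"
    unfolding fwd_orbit_eq_range by blast
  then show ?thesis
    by (rule finite_subset) simp
qed

lemma infinite_orbit_number_eq_0_if_no_wandering_points:
  assumes "wandering_points A g = {}"
  shows "infinite_orbit_number A g = 0"
proof -
  have "False"
    if "k \<ge> 1" "\<O> \<subseteq> fwd_orbit g ` A" "card \<O> = k" "\<forall>S\<in>\<O>. infinite S" for k \<O>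
  proof -
    have "\<O> \<noteq> {}"
      using that by force
    then show False
      using that assms by (auto simp: wandering_points_def)
  qed
  then have "{enat k | k. k \<ge> 1 \<and>
       (\<exists>\<O>. \<O> \<subseteq> fwd_orbit g ` A \<and> card \<O> = k \<and>
            (\<forall>S\<in>\<O>. infinite S) \<and> pairwise disjnt \<O>)} = {}"
    by blast
  then show ?thesis
    unfolding infinite_orbit_number_def by (simp only: Un_empty_right) simp
qed

text \<open>
  The iterated images of a finite set of points with finite orbits stay inside one finite set, so the
  quotients defining the entropy are at most a constant over \<open>n\<close>.
\<close>

lemma set_entropy_eq_0_if_no_wandering_points:
  assumes "wandering_points A g = {}"
  shows "set_entropy A g = 0"
proof -
  have "set_entropy_at g D = 0" if "finite D" "D \<subseteq> A" for D
  proof -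
    let ?U = "\<Union>d\<in>D. fwd_orbit g d"
    have fin: "finite ?U"
      using that assms by (auto simp: wandering_points_def)
    have "(\<Union>i<n. (g ^^ i) ` D) \<subseteq> ?U" for n
      by (auto simp: fwd_orbit_eq_range)
    then have bound: "card (\<Union>i<n. (g ^^ i) ` D) \<le> card ?U" for n
      by (rule card_mono[OF fin])
    have "(\<lambda>n. real (card (\<Union>i<n. (g ^^ i) ` D)) / real n) \<longlonglongrightarrow> 0"
    proof (rule tendsto_sandwich[OF _ _ tendsto_const lim_const_over_n[of "real (card ?U)"]])
      show "\<forall>\<^sub>F n in sequentially.
          real (card (\<Union>i<n. (g ^^ i) ` D)) / real n \<le> real (card ?U) / real n"
        using bound by (intro always_eventually allI divide_right_mono) simp_all
    qed simp
    then show ?thesis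
      unfolding set_entropy_at_def by (rule limI)
  qed
  then have "set_entropy A g = (SUP D \<in> {D. finite D \<and> D \<subseteq> A}. 0)"
    unfolding set_entropy_def by (intro SUP_cong) (auto simp: zero_ereal_def)
  also have "\<dots> = 0"
    by (rule SUP_const) auto
  finally show ?thesis .
qed

section \<open>Self-maps with infinitely many independent orbits\<close>

lemma infinite_fwd_orbit_of_independent:
  assumes "inj (\<lambda>(i, j). (g ^^ i) (x j))"
  shows "infinite (fwd_orbit g (x j))"
proof -
  have "inj (\<lambda>i. (g ^^ i) (x j))"
    using assms by (auto simp: inj_def)
  then show ?thesis
    unfolding fwd_orbit_eq_range by (rule range_inj_infinite)
qed

lemma infinite_orbit_number_eq_infinity_if_independent:
  fixes x :: "nat \<Rightarrow> 'a"
  assumes inj: "inj (\<lambda>(i, j). (g ^^ i) (x j))" and x: "range x \<subseteq> A"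
  shows "infinite_orbit_number A g = \<infinity>"
proof -
  have disj: "disjnt (fwd_orbit g (x j)) (fwd_orbit g (x l))" if "j \<noteq> l" for j l
    using inj that by (fastforce simp: disjnt_iff fwd_orbit_eq_range inj_def)
  have inj_orbit: "inj (\<lambda>j. fwd_orbit g (x j))"
  proof (rule injI, rule ccontr)
    fix j l assume "fwd_orbit g (x j) = fwd_orbit g (x l)" "j \<noteq> l"
    with disj[of j l] have "fwd_orbit g (x j) = {}"
      by simp
    then show False
      using infinite_fwd_orbit_of_independent[OF inj, of j] by simp
  qed
  have lower: "enat k \<le> infinite_orbit_number A g" for k
  proof (cases "k = 0")
    case False
    let ?O = "(\<lambda>j. fwd_orbit g (x j)) ` {..<k}"
    have "?O \<subseteq> fwd_orbit g ` A"
      using x by auto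
    moreover have "card ?O = k"
      using inj_orbit by (subst card_image) (auto intro: inj_on_subset)
    moreover have "\<forall>S\<in>?O. infinite S"
      using infinite_fwd_orbit_of_independent[OF inj] by blast
    moreover have "pairwise disjnt ?O"
      using disj unfolding pairwise_def by (metis (no_types, lifting) imageE)
    ultimately show ?thesis
      unfolding infinite_orbit_number_def using False
      by (intro Sup_upper UnI2 CollectI exI[of _ k] conjI exI[of _ ?O]) auto
  qed (simp add: zero_enat_def[symmetric])
  show ?thesis
  proof (cases "infinite_orbit_number A g")
    case (enat k)
    then show ?thesis
      using lower[of "Suc k"] by simp
  qed simp
qed

text \<open>
  For the first \<open>k\<close> independent points, the union of the first \<open>n\<close> iterated images has exactly \<open>n * k\<close>
  elements.
\<close>

lemma set_entropy_eq_infinity_if_independent: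
  fixes x :: "nat \<Rightarrow> 'a"
  assumes inj: "inj (\<lambda>(i, j). (g ^^ i) (x j))" and x: "range x \<subseteq> A"
  shows "set_entropy A g = \<infinity>"
proof -
  have at: "set_entropy_at g (x ` {..<k}) = real k" for k
  proof -
    have "card (\<Union>i<n. (g ^^ i) ` x ` {..<k}) = n * k" for n
    proof -
      have "(\<Union>i<n. (g ^^ i) ` x ` {..<k}) = (\<lambda>(i, j). (g ^^ i) (x j)) ` ({..<n} \<times> {..<k})"
        by auto
      then show ?thesis
        by (simp add: card_image[OF inj_on_subset[OF inj]])
    qed
    then have "\<forall>\<^sub>F n in sequentially. real (card (\<Union>i<n. (g ^^ i) ` x ` {..<k})) / real n = real k"
      by (intro eventually_sequentiallyI[of 1]) simp
    then show ?thesis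
      unfolding set_entropy_at_def by (intro limI tendsto_eventually)
  qed
  have "\<exists>D\<in>{D. finite D \<and> D \<subseteq> A}. ereal (real k) \<le> ereal (set_entropy_at g D)" for k
    using at[of k] x by (intro bexI[of _ "x ` {..<k}"]) auto
  then show ?thesis
    unfolding set_entropy_def by (intro SUP_PInfty) blast
qed

section \<open>Moved points of maps that are not quasi-periodic\<close>

text \<open>
  Write \<open>G\<close> for the image of \<open>\<phi>\<^sup>i\<close> and \<open>d = k - i\<close>. The finite set \<open>B\<close> below consists of the points of \<open>G\<close>
  that \<open>\<phi>\<^sup>d\<close> moves. A point of \<open>B\<close> travels inside \<open>B\<close> under \<open>\<phi>\<^sup>d\<close> until it leaves \<open>B\<close>, necessarily to a
  fixed point of \<open>\<phi>\<^sup>d\<close>. So all the powers of \<open>\<phi>\<^sup>d\<close> map \<open>B\<close> into the finite set \<open>B \<union> \<phi>\<^sup>d B\<close> and fix the rest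
  of \<open>G\<close>, and two of them agree on \<open>G\<close> by the pigeonhole principle.
\<close>

lemma quasi_periodic_on_if_finite_moved:
  assumes \<phi>: "\<phi> \<in> \<Gamma> \<rightarrow> \<Gamma>" and "i < k"
    and fin: "finite {(\<phi> ^^ i) \<alpha> | \<alpha>. \<alpha> \<in> \<Gamma> \<and> (\<phi> ^^ i) \<alpha> \<noteq> (\<phi> ^^ k) \<alpha>}"
  shows "quasi_periodic_on \<Gamma> \<phi>"
proof -
  define B where "B = {(\<phi> ^^ i) \<alpha> | \<alpha>. \<alpha> \<in> \<Gamma> \<and> (\<phi> ^^ i) \<alpha> \<noteq> (\<phi> ^^ k) \<alpha>}"
  define G where "G = (\<phi> ^^ i) ` \<Gamma>"
  define \<psi> where "\<psi> = \<phi> ^^ (k - i)"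
  have k: "(\<phi> ^^ k) \<alpha> = \<psi> ((\<phi> ^^ i) \<alpha>)" for \<alpha>
    using \<open>i < k\<close> funpow_add[of "k - i" i \<phi>] by (simp add: \<psi>_def)
  have closed: "(\<phi> ^^ n) \<alpha> \<in> \<Gamma>" if "\<alpha> \<in> \<Gamma>" for n \<alpha>
    using that \<phi> by (induction n) auto
  have B_eq: "B = {\<beta> \<in> G. \<psi> \<beta> \<noteq> \<beta>}"
    unfolding B_def G_def k by force
  have \<psi>_G: "\<psi> \<beta> \<in> G" if \<beta>: "\<beta> \<in> G" for \<beta>
  proof -
    obtain \<alpha> where "\<alpha> \<in> \<Gamma>" "\<beta> = (\<phi> ^^ i) \<alpha>"
      using \<beta> unfolding G_def by blast
    then have "\<psi> \<beta> = (\<phi> ^^ i) (\<psi> \<alpha>)"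
      unfolding \<psi>_def by (metis add.commute comp_apply funpow_add)
    then show ?thesis
      using closed[OF \<open>\<alpha> \<in> \<Gamma>\<close>] by (simp add: G_def \<psi>_def)
  qed
  have fixed: "(\<psi> ^^ t) \<beta> = \<beta>" if "\<beta> \<in> G - B" for t \<beta>
    using that by (induction t) (auto simp: B_eq)
  have stay: "(\<psi> ^^ t) \<beta> \<in> B \<union> \<psi> ` B" if "\<beta> \<in> B" for t \<beta>
    using that
  proof (induction t)
    case (Suc t)
    show ?case
    proof (cases "(\<psi> ^^ t) \<beta> \<in> B")
      case False
      then have "(\<psi> ^^ t) \<beta> \<in> \<psi> ` B"
        using Suc by blast
      with False have "(\<psi> ^^ t) \<beta> \<in> G - B"
        using \<psi>_G by (auto simp: B_eq)
      then show ?thesis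
        using \<open>(\<psi> ^^ t) \<beta> \<in> \<psi> ` B\<close> by (auto simp: B_eq)
    qed simp
  qed simp
  have "finite (B \<rightarrow>\<^sub>E (B \<union> \<psi> ` B))"
    using fin by (intro finite_PiE) (auto simp: B_def)
  moreover have "(\<lambda>t. restrict (\<psi> ^^ t) B) ` {1..} \<subseteq> B \<rightarrow>\<^sub>E (B \<union> \<psi> ` B)"
    using stay by (intro image_subsetI) (unfold restrict_PiE_iff, blast)
  ultimately have "finite ((\<lambda>t. restrict (\<psi> ^^ t) B) ` {1..})"
    by (rule finite_subset[rotated])
  then have "\<not> inj_on (\<lambda>t. restrict (\<psi> ^^ t) B) {1..}"
    using finite_imageD infinite_Ici by blast
  then obtain s t where "1 \<le> s" "s < t" and eq: "restrict (\<psi> ^^ s) B = restrict (\<psi> ^^ t) B"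
    by (auto simp: inj_on_def) (metis linorder_neqE_nat)
  have \<psi>_eq: "(\<psi> ^^ s) \<beta> = (\<psi> ^^ t) \<beta>" if "\<beta> \<in> G" for \<beta>
    using that fixed fun_cong[OF eq, of \<beta>] by (cases "\<beta> \<in> B") simp_all
  have pow: "(\<phi> ^^ ((k - i) * u + i)) \<alpha> = (\<psi> ^^ u) ((\<phi> ^^ i) \<alpha>)" for u \<alpha>
    by (simp add: \<psi>_def funpow_add funpow_mult)
  show ?thesis
    unfolding quasi_periodic_on_def
  proof (rule exI[of _ "(k - i) * t + i"], rule exI[of _ "(k - i) * s + i"], intro conjI ballI)
    show "(k - i) * s + i < (k - i) * t + i"
      using \<open>s < t\<close> \<open>i < k\<close> by simp
    show "1 \<le> (k - i) * s + i"
      using \<open>1 \<le> s\<close> \<open>i < k\<close> by (simp add: Suc_le_eq)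
    fix \<alpha> assume "\<alpha> \<in> \<Gamma>"
    then show "(\<phi> ^^ ((k - i) * t + i)) \<alpha> = (\<phi> ^^ ((k - i) * s + i)) \<alpha>"
      unfolding pow by (intro \<psi>_eq[symmetric]) (simp add: G_def)
  qed
qed

section \<open>Generic points of the power\<close>

text \<open>
  A finite approximation is a finite set on which the values are final, together with a function.
  Since infinitely many left components are available for each requirement, one of them lies outside
  the finite set, and the function can still be changed there so that it separates the pair.
\<close>

lemma ex_generic_function:
  fixes E :: "'c::countable \<Rightarrow> ('k \<times> 'k) set"
  shows "\<exists>f :: 'k \<Rightarrow> bool. \<forall>c. infinite (fst ` {p \<in> E c. fst p \<noteq> snd p}) \<longrightarrow>
           (\<exists>(u, v) \<in> E c. f u \<noteq> f v)"
proof -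
  define sep :: "nat \<Rightarrow> 'k set \<Rightarrow> ('k \<Rightarrow> bool) \<Rightarrow> bool" where
    "sep n F h \<longleftrightarrow> (infinite (fst ` {p \<in> E (from_nat n). fst p \<noteq> snd p}) \<longrightarrow>
       (\<exists>(u, v) \<in> E (from_nat n). u \<in> F \<and> v \<in> F \<and> h u \<noteq> h v))" for n F h
  let ?R = "\<lambda>n S S'. fst S \<subseteq> fst S' \<and> (\<forall>w\<in>fst S. snd S' w = snd S w) \<and> sep n (fst S') (snd S')"
  have "\<exists>S. \<forall>n. finite (fst (S n)) \<and> ?R n (S n) (S (Suc n))"
  proof (rule dependent_nat_choice)
    show "\<exists>S :: 'k set \<times> ('k \<Rightarrow> bool). finite (fst S)"
      by (intro exI[of _ "({}, \<lambda>_. False)"]) simp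
    fix S :: "'k set \<times> ('k \<Rightarrow> bool)" and n
    assume "finite (fst S)"
    obtain F h where S: "S = (F, h)"
      by (cases S)
    show "\<exists>S'. finite (fst S') \<and> ?R n S S'"
    proof (cases "infinite (fst ` {p \<in> E (from_nat n). fst p \<noteq> snd p})")
      case True
      then have "\<not> fst ` {p \<in> E (from_nat n). fst p \<noteq> snd p} \<subseteq> F"
        using \<open>finite (fst S)\<close> S finite_subset by auto
      then obtain p where "p \<in> E (from_nat n)" "fst p \<noteq> snd p" "fst p \<notin> F"
        by blast
      then obtain u v where uv: "(u, v) \<in> E (from_nat n)" "u \<noteq> v" "u \<notin> F"
        by (cases p) simp
      show ?thesis
        using uv \<open>finite (fst S)\<close>
        by (intro exI[of _ "(insert u (insert v F), h(u := \<not> h v))"])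
          (auto simp: S sep_def intro!: bexI[of _ "(u, v)"])
    next
      case False
      then show ?thesis
        using \<open>finite (fst S)\<close> by (intro exI[of _ S]) (auto simp: S sep_def)
    qed
  qed
  then obtain S where step: "\<And>n. ?R n (S n) (S (Suc n))"
    by blast
  define F where "F n = fst (S n)" for n
  define h where "h n = snd (S n)" for n
  have F_Suc: "F n \<subseteq> F (Suc n)" and h_Suc: "w \<in> F n \<Longrightarrow> h (Suc n) w = h n w"
    and sep: "sep n (F (Suc n)) (h (Suc n))" for n w
    using step[of n] by (auto simp: F_def h_def)
  have stable: "h m w = h n w" if "n \<le> m" "w \<in> F n" for n m w
  proof -
    have "w \<in> F m \<and> h m w = h n w"
      using \<open>n \<le> m\<close> by (induction m rule: dec_induct) (use \<open>w \<in> F n\<close> F_Suc h_Suc in auto)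
    then show ?thesis ..
  qed
  define f where "f w = h (LEAST n. w \<in> F n) w" for w
  have f: "f w = h n w" if "w \<in> F n" for w n
    using that stable[of "LEAST n. w \<in> F n" n w]
    by (simp add: f_def LeastI[of "\<lambda>n. w \<in> F n"] Least_le)
  show ?thesis
  proof (intro exI[of _ f] allI impI)
    fix c
    assume "infinite (fst ` {p \<in> E c. fst p \<noteq> snd p})"
    then show "\<exists>(u, v) \<in> E c. f u \<noteq> f v"
      using sep[of "to_nat c"] f by (fastforce simp: sep_def)
  qed
qed

lemma generalized_shift_funpow:
  assumes \<phi>: "\<phi> \<in> \<Gamma> \<rightarrow> \<Gamma>" and x: "x \<in> \<Gamma> \<rightarrow>\<^sub>E X"
  shows "(generalized_shift \<Gamma> \<phi> ^^ n) x = (\<lambda>\<alpha>\<in>\<Gamma>. x ((\<phi> ^^ n) \<alpha>))"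
proof (induction n)
  case 0
  then show ?case
    using x by simp
next
  case (Suc n)
  have "(generalized_shift \<Gamma> \<phi> ^^ Suc n) x = generalized_shift \<Gamma> \<phi> (\<lambda>\<alpha>\<in>\<Gamma>. x ((\<phi> ^^ n) \<alpha>))"
    by (simp only: funpow.simps comp_apply Suc.IH)
  also have "\<dots> = (\<lambda>\<alpha>\<in>\<Gamma>. x ((\<phi> ^^ Suc n) \<alpha>))"
    using \<phi> by (auto simp: generalized_shift_def fun_eq_iff funpow_swap1)
  finally show ?case .
qed

lemma quasi_periodic_on_generalized_shift:
  assumes \<phi>: "\<phi> \<in> \<Gamma> \<rightarrow> \<Gamma>" and "quasi_periodic_on \<Gamma> \<phi>"
  shows "quasi_periodic_on (\<Gamma> \<rightarrow>\<^sub>E X) (generalized_shift \<Gamma> \<phi>)"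
proof -
  obtain n m where "m < n" "1 \<le> m" "\<forall>\<alpha>\<in>\<Gamma>. (\<phi> ^^ n) \<alpha> = (\<phi> ^^ m) \<alpha>"
    using assms(2) unfolding quasi_periodic_on_def by blast
  then show ?thesis
    unfolding quasi_periodic_on_def
    by (intro exI[of _ n] exI[of _ m])
      (auto simp: generalized_shift_funpow[OF \<phi>] intro!: restrict_ext)
qed

text \<open>
  A single generic two-valued function on \<open>\<nat> \<times> \<Gamma>\<close> provides all the points at once, the one with
  index \<open>j\<close> being its section at \<open>j\<close>. As inequality is symmetric, the requirements with
  \<open>i \<le> k\<close> suffice; those with \<open>j \<noteq> l\<close> need infinitely many values of \<open>\<phi>\<^sup>i\<close>, and those with \<open>j = l\<close>
  and \<open>i < k\<close> infinitely many moved ones.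
\<close>

lemma not_quasi_periodic_imp_independent_points:
  assumes \<phi>: "\<phi> \<in> \<Gamma> \<rightarrow> \<Gamma>" and not_qp: "\<not> quasi_periodic_on \<Gamma> \<phi>"
    and ab: "a \<in> X" "b \<in> X" "a \<noteq> b"
  obtains x :: "nat \<Rightarrow> 'g \<Rightarrow> 'x"
  where "range x \<subseteq> \<Gamma> \<rightarrow>\<^sub>E X" "inj (\<lambda>(i, j). (generalized_shift \<Gamma> \<phi> ^^ i) (x j))"
proof -
  define E :: "(nat \<times> nat) \<times> (nat \<times> nat) \<Rightarrow> ((nat \<times> 'g) \<times> (nat \<times> 'g)) set" where
    "E = (\<lambda>((i, j), (k, l)). {((j, (\<phi> ^^ i) \<alpha>), (l, (\<phi> ^^ k) \<alpha>)) | \<alpha>. \<alpha> \<in> \<Gamma>})"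
  obtain f :: "nat \<times> 'g \<Rightarrow> bool" where
    f: "\<And>c. infinite (fst ` {p \<in> E c. fst p \<noteq> snd p}) \<Longrightarrow> \<exists>(u, v) \<in> E c. f u \<noteq> f v"
    using ex_generic_function[of E] by blast
  define x where "x j = (\<lambda>\<gamma>\<in>\<Gamma>. if f (j, \<gamma>) then a else b)" for j
  have x: "x j \<in> \<Gamma> \<rightarrow>\<^sub>E X" for j
    using ab by (auto simp: x_def)
  have closed: "(\<phi> ^^ n) \<alpha> \<in> \<Gamma>" if "\<alpha> \<in> \<Gamma>" for n \<alpha>
    using that \<phi> by (induction n) auto
  have moved: "infinite {(\<phi> ^^ i) \<alpha> | \<alpha>. \<alpha> \<in> \<Gamma> \<and> (\<phi> ^^ i) \<alpha> \<noteq> (\<phi> ^^ k) \<alpha>}" if "i < k" for i k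
    using quasi_periodic_on_if_finite_moved[OF \<phi> that] not_qp by blast
  have distinct: "(generalized_shift \<Gamma> \<phi> ^^ i) (x j) \<noteq> (generalized_shift \<Gamma> \<phi> ^^ k) (x l)"
    if ik: "i \<le> k" and ne: "(i, j) \<noteq> (k, l)" for i j k l
  proof -
    let ?L = "fst ` {p \<in> E ((i, j), (k, l)). fst p \<noteq> snd p}"
    let ?M = "\<lambda>k. {(\<phi> ^^ i) \<alpha> | \<alpha>. \<alpha> \<in> \<Gamma> \<and> (\<phi> ^^ i) \<alpha> \<noteq> (\<phi> ^^ k) \<alpha>}"
    obtain k' where "i < k'" "?M k' \<subseteq> snd ` ?L"
    proof (cases "j = l")
      case True
      then have "?M k \<subseteq> snd ` ?L"
        by (force simp: E_def image_iff)
      moreover have "i < k"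
        using True ik ne by auto
      ultimately show ?thesis
        using that by blast
    next
      case False
      \<comment> \<open>Any larger exponent serves here: already the moved points show that \<open>\<phi>\<^sup>i\<close> has infinitely many
        values.\<close>
      then have "?M (Suc i) \<subseteq> snd ` ?L"
        by (force simp: E_def image_iff)
      then show ?thesis
        using that[OF lessI] by blast
    qed
    then have "infinite (snd ` ?L)"
      using moved finite_subset by blast
    then have "infinite ?L"
      using finite_imageI by blast
    then obtain \<alpha> where "\<alpha> \<in> \<Gamma>" "f (j, (\<phi> ^^ i) \<alpha>) \<noteq> f (l, (\<phi> ^^ k) \<alpha>)"
      using f[of "((i, j), (k, l))"] by (auto simp: E_def)
    then have "(generalized_shift \<Gamma> \<phi> ^^ i) (x j) \<alpha> \<noteq> (generalized_shift \<Gamma> \<phi> ^^ k) (x l) \<alpha>"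
      using ab closed unfolding generalized_shift_funpow[OF \<phi> x] by (auto simp: x_def)
    then show ?thesis
      by metis
  qed
  show thesis
  proof
    show "range x \<subseteq> \<Gamma> \<rightarrow>\<^sub>E X"
      using x by blast
    show "inj (\<lambda>(i, j). (generalized_shift \<Gamma> \<phi> ^^ i) (x j))"
    proof (rule injI, clarify)
      fix i j k l
      assume "(generalized_shift \<Gamma> \<phi> ^^ i) (x j) = (generalized_shift \<Gamma> \<phi> ^^ k) (x l)"
      then show "i = k \<and> j = l"
        using distinct[of i k j l] distinct[of k i l j] by (metis nat_le_linear prod.inject)
    qed
  qed
qed

section \<open>The characterisation of quasi-periodicity\<close>

theorem theorem2p4:
  fixes X :: "'x set" and \<Gamma> :: "'g set" and \<phi> :: "'g \<Rightarrow> 'g"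
  assumes X: "\<exists>a\<in>X. \<exists>b\<in>X. a \<noteq> b"
    and \<Gamma>: "\<Gamma> \<noteq> {}"
    and \<phi>: "\<phi> \<in> \<Gamma> \<rightarrow> \<Gamma>"
  shows
    "let XG = \<Gamma> \<rightarrow>\<^sub>E X;
         \<sigma> = (generalized_shift \<Gamma> \<phi> :: ('g \<Rightarrow> 'x) \<Rightarrow> ('g \<Rightarrow> 'x))
     in
       (wandering_points XG \<sigma> = {} \<longleftrightarrow> quasi_periodic_on \<Gamma> \<phi>) \<and>
       (quasi_periodic_on \<Gamma> \<phi> \<longleftrightarrow> set_entropy XG \<sigma> < \<infinity>) \<and>
       (wandering_points XG \<sigma> = {} \<longleftrightarrow> infinite_orbit_number XG \<sigma> = 0) \<and>
       (wandering_points XG \<sigma> = {} \<longleftrightarrow> set_entropy XG \<sigma> = 0) \<and>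
       (set_entropy XG \<sigma> < \<infinity> \<longleftrightarrow> infinite_orbit_number XG \<sigma> < \<infinity>)"
proof -
  let ?XG = "\<Gamma> \<rightarrow>\<^sub>E X"
  let ?\<sigma> = "generalized_shift \<Gamma> \<phi> :: ('g \<Rightarrow> 'x) \<Rightarrow> ('g \<Rightarrow> 'x)"
  show ?thesis
  proof (cases "quasi_periodic_on \<Gamma> \<phi>")
    case True
    then have "wandering_points ?XG ?\<sigma> = {}"
      using quasi_periodic_on_imp_finite_fwd_orbit quasi_periodic_on_generalized_shift[OF \<phi>]
      by (fastforce simp: wandering_points_def)
    then show ?thesis
      using True infinite_orbit_number_eq_0_if_no_wandering_points[of ?XG ?\<sigma>]
        set_entropy_eq_0_if_no_wandering_points[of ?XG ?\<sigma>]
      by (simp only: Let_def) simp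
  next
    case False
    obtain a b where "a \<in> X" "b \<in> X" "a \<noteq> b"
      using X by blast
    then obtain x :: "nat \<Rightarrow> 'g \<Rightarrow> 'x"
      where x: "range x \<subseteq> ?XG" and inj: "inj (\<lambda>(i, j). (?\<sigma> ^^ i) (x j))"
      by (rule not_quasi_periodic_imp_independent_points[OF \<phi> False])
    have "x 0 \<in> wandering_points ?XG ?\<sigma>"
      using x infinite_fwd_orbit_of_independent[OF inj] by (auto simp: wandering_points_def)
    then have "wandering_points ?XG ?\<sigma> \<noteq> {}"
      by blast
    then show ?thesis
      using False infinite_orbit_number_eq_infinity_if_independent[OF inj x]
        set_entropy_eq_infinity_if_independent[OF inj x]
      by (simp add: Let_def)
  qed
qed

end
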